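(* Let $P\in\mathrm{Gr}(\mathcal{K},\Gamma)$ and let $X$ and $X'$ be finite disjoint subsets of $\mathfrak{X}$. Then $P_{X,X'}\in\mathrm{Gr}\big(\mathcal{K}_{\mathfrak{X}\setminus(X\sqcup X')},\Gamma_{\mathfrak{X}\setminus(X\sqcup X')}\big)$.
   Context: $\mathfrak{X}$ is a countable set; $e_{x}\in\ell^{2}(\mathfrak{X})$ is $e_{x}(y)=\delta_{x,y}$; $J$ is the antilinear complex conjugation on $\ell^{2}(\mathfrak{X})$ fixing each $e_{x}$; $\mathcal{K}=\ell^{2}(\mathfrak{X})\oplus\ell^{2}(\mathfrak{X})$ and $\Gamma=\begin{pmatrix}0 & J\\ J & 0\end{pmatrix}$. For $A\subset\mathfrak{X}$: $\mathcal{K}_{A}^{+}$ (resp. $\mathcal{K}_{A}^{-}$) is the closed span of $\{(e_{x},0):x\in A\}$ (resp. $\{(0,e_{x}):x\in A\}$), $\mathcal{K}_{A}=\mathcal{K}_{A}^{+}\oplus\mathcal{K}_{A}^{-}$ and $\Gamma_{A}=\Gamma|_{\mathcal{K}_{A}}$ (an anti-unitary involution of $\mathcal{K}_{A}$). $\mathrm{Gr}(\mathcal{K}_{A},\Gamma_{A})$ is the set of orthogonal projections $P$ on $\mathcal{K}_{A}$ with $\Gamma_{A}P\Gamma_{A}=1-P$; $\mathrm{Gr}(\mathcal{K},\Gamma)$ is the case $A=\mathfrak{X}$. For $P\in\mathrm{Gr}(\mathcal{K},\Gamma)$ and finite disjoint $X,X'\subset\mathfrak{X}$, $P_{X,X'}$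 is the orthogonal projection in $\mathcal{K}_{\mathfrak{X}\setminus(X\sqcup X')}$ onto the closed subspace $$P\mathcal{K}_{X,X'}:=\big(P\mathcal{K}+(\mathcal{K}_{X}^{+}\oplus\mathcal{K}_{X'}^{-})\big)\cap\mathcal{K}_{\mathfrak{X}\setminus(X\sqcup X')}.$$ *)

theory Defs
  imports "HOL-Analysis.Analysis"
begin

section \<open>The Hilbert space of square summable families\<close>

typedef 'x ell2 = "{f :: 'x \<Rightarrow> complex. (\<lambda>x. (cmod (f x))\<^sup>2) summable_on UNIV}"
  morphisms ell2_fun Abs_ell2
  by (intro exI[of _ "\<lambda>_. 0"]) simp

setup_lifting type_definition_ell2

lemma square_summable_add:
  fixes f g :: "'x \<Rightarrow> complex"
  assumes "(\<lambda>x. (cmod (f x))\<^sup>2) summable_on UNIV" "(\<lambda>x. (cmod (g x))\<^sup>2) summable_on UNIV"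
  shows "(\<lambda>x. (cmod (f x + g x))\<^sup>2) summable_on UNIV"
proof (rule summable_on_comparison_test)
  show "(\<lambda>x. 2 * (cmod (f x))\<^sup>2 + 2 * (cmod (g x))\<^sup>2) summable_on UNIV"
    by (intro summable_on_add summable_on_cmult_right assms)
  fix x
  have "(cmod (f x + g x))\<^sup>2 \<le> (cmod (f x) + cmod (g x))\<^sup>2"
    by (intro power_mono norm_triangle_ineq) auto
  also have "\<dots> \<le> 2 * (cmod (f x))\<^sup>2 + 2 * (cmod (g x))\<^sup>2"
    using zero_le_power2[of "cmod (f x) - cmod (g x)"] by (simp add: power2_eq_square algebra_simps)
  finally show "(cmod (f x + g x))\<^sup>2 \<le> 2 * (cmod (f x))\<^sup>2 + 2 * (cmod (g x))\<^sup>2" .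
qed auto

lemma square_summable_scale:
  fixes f :: "'x \<Rightarrow> complex"
  assumes "(\<lambda>x. (cmod (f x))\<^sup>2) summable_on UNIV"
  shows "(\<lambda>x. (cmod (c * f x))\<^sup>2) summable_on UNIV"
  using summable_on_cmult_right[OF assms, of "(cmod c)\<^sup>2"]
  by (simp add: norm_mult power_mult_distrib)

lemma product_summable:
  fixes f g :: "'x \<Rightarrow> complex"
  assumes "(\<lambda>x. (cmod (f x))\<^sup>2) summable_on UNIV" "(\<lambda>x. (cmod (g x))\<^sup>2) summable_on UNIV"
  shows "(\<lambda>x. cmod (f x) * cmod (g x)) summable_on UNIV"
proof (rule summable_on_comparison_test)
  show "(\<lambda>x. (cmod (f x))\<^sup>2 + (cmod (g x))\<^sup>2) summable_on UNIV"
    by (intro summable_on_add assms)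
  show "cmod (f x) * cmod (g x) \<le> (cmod (f x))\<^sup>2 + (cmod (g x))\<^sup>2" for x
    using sum_squares_bound[of "cmod (f x)" "cmod (g x)"]
      mult_nonneg_nonneg[OF norm_ge_zero[of "f x"] norm_ge_zero[of "g x"]] by linarith
qed auto

lemma square_summable_ell2: "(\<lambda>x. (cmod (ell2_fun f x))\<^sup>2) summable_on UNIV"
  using ell2_fun[of f] by simp

lemma inner_summable_ell2:
  fixes f g :: "'x ell2"
  shows "(\<lambda>x. ell2_fun f x \<bullet> ell2_fun g x) summable_on UNIV"
proof (rule abs_summable_summable, rule summable_on_comparison_test)
  show "(\<lambda>x. cmod (ell2_fun f x) * cmod (ell2_fun g x)) summable_on UNIV"
    by (intro product_summable square_summable_ell2)
qed (auto simp: Cauchy_Schwarz_ineq2)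

text \<open>
  The library has no class of complex inner product spaces. We give the Hilbert space of square
  summable families its real inner product, i.e. the real part of the complex one, from which it
  inherits norm and topology, and define the complex scalar multiplication and the complex inner
  product separately below.
\<close>

instantiation ell2 :: (type) real_inner
begin

lift_definition zero_ell2 :: "'a ell2" is "\<lambda>_. 0" by simp

lift_definition plus_ell2 :: "'a ell2 \<Rightarrow> 'a ell2 \<Rightarrow> 'a ell2" is "\<lambda>f g x. f x + g x"
  by (rule square_summable_add)

lift_definition uminus_ell2 :: "'a ell2 \<Rightarrow> 'a ell2" is "\<lambda>f x. - f x" by simp

lift_definition minus_ell2 :: "'a ell2 \<Rightarrow> 'a ell2 \<Rightarrow> 'a ell2" is "\<lambda>f g x. f x - g x"
proof -
  fix f g :: "'a \<Rightarrow> complex"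
  assume "(\<lambda>x. (cmod (f x))\<^sup>2) summable_on UNIV" "(\<lambda>x. (cmod (g x))\<^sup>2) summable_on UNIV"
  thus "(\<lambda>x. (cmod (f x - g x))\<^sup>2) summable_on UNIV"
    using square_summable_add[of f "\<lambda>x. - g x"] by simp
qed

lift_definition scaleR_ell2 :: "real \<Rightarrow> 'a ell2 \<Rightarrow> 'a ell2" is "\<lambda>r f x. complex_of_real r * f x"
  by (rule square_summable_scale)

lift_definition inner_ell2 :: "'a ell2 \<Rightarrow> 'a ell2 \<Rightarrow> real" is "\<lambda>f g. \<Sum>\<^sub>\<infinity>x. f x \<bullet> g x" .

definition norm_ell2 :: "'a ell2 \<Rightarrow> real" where "norm_ell2 f = sqrt (inner f f)"

definition sgn_ell2 :: "'a ell2 \<Rightarrow> 'a ell2" where "sgn_ell2 f = inverse (norm f) *\<^sub>R f"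

definition dist_ell2 :: "'a ell2 \<Rightarrow> 'a ell2 \<Rightarrow> real" where "dist_ell2 f g = norm (f - g)"

definition uniformity_ell2 :: "('a ell2 \<times> 'a ell2) filter" where
  "uniformity_ell2 = (INF e\<in>{0<..}. principal {(f, g). dist f g < e})"

definition open_ell2 :: "'a ell2 set \<Rightarrow> bool" where
  "open_ell2 U \<longleftrightarrow> (\<forall>f\<in>U. \<forall>\<^sub>F (f', g) in uniformity. f' = f \<longrightarrow> g \<in> U)"

instance
proof
  fix f g h :: "'a ell2" and r s :: real
  show "f + g + h = f + (g + h)" by transfer (simp add: algebra_simps)
  show "f + g = g + f" by transfer (simp add: algebra_simps)
  show "0 + f = f" by transfer simp
  show "- f + f = 0" by transfer simp
  show "f - g = f + - g" by transfer simp
  show "r *\<^sub>R (f + g) = r *\<^sub>R f + r *\<^sub>R g" by transfer (simp add: algebra_simps)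
  show "(r + s) *\<^sub>R f = r *\<^sub>R f + s *\<^sub>R f" by transfer (simp add: algebra_simps)
  show "r *\<^sub>R s *\<^sub>R f = (r * s) *\<^sub>R f" by transfer (simp add: algebra_simps)
  show "1 *\<^sub>R f = f" by transfer simp
  show "sgn f = inverse (norm f) *\<^sub>R f" by (rule sgn_ell2_def)
  show "dist f g = norm (f - g)" by (rule dist_ell2_def)
  show "(uniformity :: ('a ell2 \<times> 'a ell2) filter) = (INF e\<in>{0<..}. principal {(f, g). dist f g < e})"
    by (rule uniformity_ell2_def)
  show "open U \<longleftrightarrow> (\<forall>f\<in>U. \<forall>\<^sub>F (f', g) in uniformity. f' = f \<longrightarrow> g \<in> U)" for U :: "'a ell2 set"
    by (rule open_ell2_def)
  show "inner f g = inner g f" by transfer (simp add: inner_commute)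
  have "inner (f + g) h = (\<Sum>\<^sub>\<infinity>x. ell2_fun f x \<bullet> ell2_fun h x + ell2_fun g x \<bullet> ell2_fun h x)"
    by transfer (simp add: inner_add_left)
  also have "\<dots> = inner f h + inner g h"
    by (subst infsum_add) (auto simp: inner_summable_ell2 inner_ell2.rep_eq)
  finally show "inner (f + g) h = inner f h + inner g h" .
  have "inner (r *\<^sub>R f) g = (\<Sum>\<^sub>\<infinity>x. r * (ell2_fun f x \<bullet> ell2_fun g x))"
    by transfer (simp add: scaleR_conv_of_real[symmetric])
  also have "\<dots> = r * inner f g"
    by (simp add: infsum_cmult_right' inner_ell2.rep_eq)
  finally show "inner (r *\<^sub>R f) g = r * inner f g" .
  show "0 \<le> inner f f" by transfer (simp add: infsum_nonneg)
  show "inner f f = 0 \<longleftrightarrow> f = 0"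
  proof
    assume "inner f f = 0"
    hence "(\<Sum>\<^sub>\<infinity>x. ell2_fun f x \<bullet> ell2_fun f x) = 0" by (simp add: inner_ell2.rep_eq)
    hence "ell2_fun f x \<bullet> ell2_fun f x = 0" for x
      by (intro nonneg_infsum_le_0D[where A = UNIV]) (auto intro: inner_summable_ell2)
    thus "f = 0" by transfer auto
  qed (simp add: inner_ell2.rep_eq zero_ell2.rep_eq)
  show "norm f = sqrt (inner f f)" by (rule norm_ell2_def)
qed

end

text \<open>\<open>ket x\<close> is the vector $e_x$.\<close>

lift_definition ket :: "'x \<Rightarrow> 'x ell2" is "\<lambda>x y. if y = x then 1 else 0"
proof -
  fix x :: 'x
  have "(\<lambda>y. (cmod (if y = x then 1 else 0))\<^sup>2) summable_on {x}"
    by (rule summable_on_finite) simp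
  thus "(\<lambda>y. (cmod (if y = x then 1 else 0))\<^sup>2) summable_on UNIV"
    by (rule summable_on_cong_neutral[THEN iffD1, rotated -1]) auto
qed

lift_definition conj_ell2 :: "'x ell2 \<Rightarrow> 'x ell2" is "\<lambda>f x. cnj (f x)" by simp

lift_definition scaleC_ell2 :: "complex \<Rightarrow> 'x ell2 \<Rightarrow> 'x ell2" is "\<lambda>c f x. c * f x"
  by (rule square_summable_scale)

definition cinner_ell2 :: "'x ell2 \<Rightarrow> 'x ell2 \<Rightarrow> complex" where
  "cinner_ell2 f g = (\<Sum>\<^sub>\<infinity>x. cnj (ell2_fun f x) * ell2_fun g x)"


section \<open>The doubled space\<close>

text \<open>
  The norm and topology on pairs are the library's product structure, in which
  \<open>(norm (f, g))\<^sup>2 = (norm f)\<^sup>2 + (norm g)\<^sup>2\<close>.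
\<close>

type_synonym 'x dbl = "'x ell2 \<times> 'x ell2"

definition scaleC :: "complex \<Rightarrow> 'x dbl \<Rightarrow> 'x dbl" where
  "scaleC c k = (scaleC_ell2 c (fst k), scaleC_ell2 c (snd k))"

definition cinner :: "'x dbl \<Rightarrow> 'x dbl \<Rightarrow> complex" where
  "cinner k l = cinner_ell2 (fst k) (fst l) + cinner_ell2 (snd k) (snd l)"

definition Gam :: "'x dbl \<Rightarrow> 'x dbl" where
  "Gam k = (conj_ell2 (snd k), conj_ell2 (fst k))"

lemma module_scaleC: "module (scaleC :: complex \<Rightarrow> 'x dbl \<Rightarrow> 'x dbl)"
proof
  fix a b :: complex and k l :: "'x dbl"
  have *: "scaleC_ell2 a (f + g) = scaleC_ell2 a f + scaleC_ell2 a g"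
    "scaleC_ell2 (a + b) f = scaleC_ell2 a f + scaleC_ell2 b f"
    "scaleC_ell2 a (scaleC_ell2 b f) = scaleC_ell2 (a * b) f"
    "scaleC_ell2 1 f = f" for f g :: "'x ell2"
    by (transfer; simp add: algebra_simps)+
  show "scaleC a (k + l) = scaleC a k + scaleC a l"
    "scaleC (a + b) k = scaleC a k + scaleC b k"
    "scaleC a (scaleC b k) = scaleC (a * b) k"
    "scaleC 1 k = k"
    by (simp_all add: scaleC_def *)
qed

definition closed_cspan :: "'x dbl set \<Rightarrow> 'x dbl set" where
  "closed_cspan S = closure (module.span scaleC S)"

text \<open>
  The countable index set is a set \<open>XX\<close> of elements of the type \<open>'x\<close>, and the one-particle space
  over \<open>XX\<close> is identified with the families on \<open>'x\<close> vanishing outside \<open>XX\<close>; so the doubled space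
  is \<open>K XX\<close>, and \<open>K A\<close> for \<open>A \<subseteq> XX\<close> does not depend on \<open>XX\<close>. See \<open>K_eq_supported\<close>.
\<close>

definition Kplus :: "'x set \<Rightarrow> 'x dbl set" where
  "Kplus A = closed_cspan {(ket x, 0) | x. x \<in> A}"

definition Kminus :: "'x set \<Rightarrow> 'x dbl set" where
  "Kminus A = closed_cspan {(0, ket x) | x. x \<in> A}"

definition K :: "'x set \<Rightarrow> 'x dbl set" where
  "K A = Kplus A + Kminus A"

lemma norm_ell2_sq: "(norm f)\<^sup>2 = (\<Sum>\<^sub>\<infinity>x. (cmod (ell2_fun f x))\<^sup>2)"
  by (simp add: power2_norm_eq_inner inner_ell2.rep_eq)

lemma ell2_fun_le_norm: "cmod (ell2_fun f x) \<le> norm f"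
proof (rule power2_le_imp_le)
  have "(\<Sum>\<^sub>\<infinity>y\<in>{x}. (cmod (ell2_fun f y))\<^sup>2) \<le> (\<Sum>\<^sub>\<infinity>y. (cmod (ell2_fun f y))\<^sup>2)"
    by (intro infsum_mono_neutral square_summable_ell2) auto
  thus "(cmod (ell2_fun f x))\<^sup>2 \<le> (norm f)\<^sup>2" by (simp add: norm_ell2_sq)
qed simp

lemma inner_eq_Re_cinner:
  fixes k l :: "'x dbl"
  shows "k \<bullet> l = Re (cinner k l)"
proof -
  have "f \<bullet> g = Re (cinner_ell2 f g)" for f g :: "'x ell2"
  proof -
    have "(\<lambda>x. cnj (ell2_fun f x) * ell2_fun g x) summable_on UNIV"
      by (rule abs_summable_summable)
         (simp add: norm_mult product_summable square_summable_ell2)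
    thus ?thesis
      by (simp add: cinner_ell2_def inner_ell2.rep_eq infsum_Re[symmetric] inner_complex_def)
  qed
  thus ?thesis by (cases k, cases l) (simp add: cinner_def)
qed

lemma ell2_fun_sum: "ell2_fun (sum h F) y = (\<Sum>x\<in>F. ell2_fun (h x) y)"
  by (induction F rule: infinite_finite_induct) (auto simp: zero_ell2.rep_eq plus_ell2.rep_eq)

lemma ell2_finite_approx:
  assumes "\<And>x. x \<notin> A \<Longrightarrow> ell2_fun f x = 0" "e > 0"
  obtains F where "finite F" "F \<subseteq> A" "dist (\<Sum>x\<in>F. scaleC_ell2 (ell2_fun f x) (ket x)) f < e"
proof -
  let ?s = "\<lambda>x. (cmod (ell2_fun f x))\<^sup>2"
  have summ: "?s summable_on B" for B
    by (rule summable_on_subset_banach[OF square_summable_ell2]) simp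
  have "(?s has_sum infsum ?s A) A" using summ by (rule has_sum_infsum)
  hence "(sum ?s \<longlongrightarrow> infsum ?s A) (finite_subsets_at_top A)" by (simp add: has_sum_def)
  moreover have "e\<^sup>2 > 0" using assms(2) by simp
  ultimately have "\<forall>\<^sub>F F in finite_subsets_at_top A. dist (sum ?s F) (infsum ?s A) < e\<^sup>2"
    by (rule tendstoD)
  then obtain F where F: "finite F" "F \<subseteq> A" "dist (sum ?s F) (infsum ?s A) < e\<^sup>2"
    unfolding eventually_finite_subsets_at_top by blast
  define g where "g = (\<Sum>x\<in>F. scaleC_ell2 (ell2_fun f x) (ket x))"
  have g: "ell2_fun g y = (if y \<in> F then ell2_fun f y else 0)" for y
  proof -
    have "ell2_fun g y = (\<Sum>x\<in>F. if y = x then ell2_fun f x else 0)"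
      unfolding g_def ell2_fun_sum by (intro sum.cong) (auto simp: scaleC_ell2.rep_eq ket.rep_eq)
    thus ?thesis using F(1) by simp
  qed
  have "(dist g f)\<^sup>2 = (\<Sum>\<^sub>\<infinity>x. (cmod (ell2_fun g x - ell2_fun f x))\<^sup>2)"
    by (simp add: dist_norm norm_ell2_sq minus_ell2.rep_eq)
  also have "\<dots> = infsum ?s (A - F)"
    by (rule infsum_cong_neutral) (use assms(1) g in auto)
  also have "\<dots> = infsum ?s A - infsum ?s F"
    by (rule infsum_Diff) (use F summ in auto)
  also have "\<dots> < e\<^sup>2"
    using F(1,3) by (simp add: dist_real_def)
  finally have "dist g f < e" by (rule power2_less_imp_less) (use assms(2) in simp)
  thus thesis using that F(1,2) unfolding g_def by blast
qed

interpretation dbl: module "scaleC :: complex \<Rightarrow> 'x dbl \<Rightarrow> 'x dbl"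
  by (rule module_scaleC)

lemma ell2_evals_tendsto:
  assumes "(\<lambda>n. k n) \<longlonglongrightarrow> (l :: 'x dbl)"
  shows "(\<lambda>n. ell2_fun (fst (k n)) x) \<longlonglongrightarrow> ell2_fun (fst l) x"
    and "(\<lambda>n. ell2_fun (snd (k n)) x) \<longlonglongrightarrow> ell2_fun (snd l) x"
proof -
  have *: "(\<lambda>n. ell2_fun (f n) x) \<longlonglongrightarrow> ell2_fun g x" if "f \<longlonglongrightarrow> g" for f and g :: "'x ell2"
  proof (rule Lim_null[THEN iffD2], rule Lim_null_comparison)
    show "(\<lambda>n. norm (f n - g)) \<longlonglongrightarrow> 0" using that by (simp add: LIM_zero tendsto_norm_zero)
    show "\<forall>\<^sub>F n in sequentially. cmod (ell2_fun (f n) x - ell2_fun g x) \<le> norm (f n - g)"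
      using ell2_fun_le_norm[of "f _ - g" x] by (simp add: minus_ell2.rep_eq)
  qed
  show "(\<lambda>n. ell2_fun (fst (k n)) x) \<longlonglongrightarrow> ell2_fun (fst l) x"
    "(\<lambda>n. ell2_fun (snd (k n)) x) \<longlonglongrightarrow> ell2_fun (snd l) x"
    by (intro * tendsto_fst tendsto_snd assms)+
qed

lemma closed_supported:
  "closed {k :: 'x dbl. (\<forall>x. x \<notin> A \<longrightarrow> ell2_fun (fst k) x = 0) \<and>
     (\<forall>x. x \<notin> B \<longrightarrow> ell2_fun (snd k) x = 0)}"
  unfolding closed_sequential_limits
proof (intro allI impI, elim conjE)
  fix k :: "nat \<Rightarrow> 'x dbl" and l :: "'x dbl"
  assume "\<forall>n. k n \<in> {k. (\<forall>x. x \<notin> A \<longrightarrow> ell2_fun (fst k) x = 0) \<and>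
     (\<forall>x. x \<notin> B \<longrightarrow> ell2_fun (snd k) x = 0)}" and lim: "k \<longlonglongrightarrow> l"
  hence z1: "\<And>n x. x \<notin> A \<Longrightarrow> ell2_fun (fst (k n)) x = 0"
    and z2: "\<And>n x. x \<notin> B \<Longrightarrow> ell2_fun (snd (k n)) x = 0" by blast+
  have "ell2_fun (fst l) x = 0" if "x \<notin> A" for x
    using ell2_evals_tendsto(1)[OF lim, of x] z1[OF that] by (simp add: LIMSEQ_const_iff)
  moreover have "ell2_fun (snd l) x = 0" if "x \<notin> B" for x
    using ell2_evals_tendsto(2)[OF lim, of x] z2[OF that] by (simp add: LIMSEQ_const_iff)
  ultimately show "l \<in> {k. (\<forall>x. x \<notin> A \<longrightarrow> ell2_fun (fst k) x = 0) \<and>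
     (\<forall>x. x \<notin> B \<longrightarrow> ell2_fun (snd k) x = 0)}" by blast
qed

lemma subspace_supported:
  "dbl.subspace {k :: 'x dbl. (\<forall>x. x \<notin> A \<longrightarrow> ell2_fun (fst k) x = 0) \<and>
     (\<forall>x. x \<notin> B \<longrightarrow> ell2_fun (snd k) x = 0)}"
  by (auto simp: dbl.subspace_def scaleC_def scaleC_ell2.rep_eq plus_ell2.rep_eq zero_ell2.rep_eq)

lemma ell2_fun_eq_0: "(\<forall>x. ell2_fun f x = 0) \<longleftrightarrow> f = 0"
  by transfer auto

lemma Kplus_eq_supported: "Kplus A = {(f, 0) | f. \<forall>x. x \<notin> A \<longrightarrow> ell2_fun f x = 0}"
proof (intro equalityI subsetI)
  fix k :: "'a dbl"
  assume k: "k \<in> Kplus A"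
  have "Kplus A \<subseteq> {k. (\<forall>x. x \<notin> A \<longrightarrow> ell2_fun (fst k) x = 0) \<and> (\<forall>x. x \<notin> {} \<longrightarrow> ell2_fun (snd k) x = 0)}"
    unfolding Kplus_def closed_cspan_def
    by (intro closure_minimal closed_supported dbl.span_minimal subspace_supported)
       (auto simp: ket.rep_eq zero_ell2.rep_eq)
  thus "k \<in> {(f, 0) | f. \<forall>x. x \<notin> A \<longrightarrow> ell2_fun f x = 0}"
    using k by (cases k) (auto simp: ell2_fun_eq_0)
next
  fix k :: "'a dbl"
  assume "k \<in> {(f, 0) | f. \<forall>x. x \<notin> A \<longrightarrow> ell2_fun f x = 0}"
  then obtain f where k: "k = (f, 0)" and f: "\<And>x. x \<notin> A \<Longrightarrow> ell2_fun f x = 0" by blast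
  show "k \<in> Kplus A"
    unfolding Kplus_def closed_cspan_def closure_approachable
  proof (intro allI impI)
    fix e :: real assume "e > 0"
    obtain F where F: "finite F" "F \<subseteq> A"
        "dist (\<Sum>x\<in>F. scaleC_ell2 (ell2_fun f x) (ket x)) f < e"
      using ell2_finite_approx[OF f \<open>e > 0\<close>] by metis
    let ?l = "\<Sum>x\<in>F. scaleC (ell2_fun f x) (ket x, 0)"
    have z: "scaleC_ell2 c 0 = 0" for c :: complex by transfer simp
    have "?l = ((\<Sum>x\<in>F. scaleC_ell2 (ell2_fun f x) (ket x)), 0)"
      by (simp add: scaleC_def sum_prod z)
    hence "dist ?l k < e" using F(3) by (simp add: k dist_Pair_Pair)
    moreover have "?l \<in> dbl.span {(ket x, 0) | x. x \<in> A}"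
      using F(2) by (intro dbl.span_sum dbl.span_scale dbl.span_base) auto
    ultimately show "\<exists>y\<in>dbl.span {(ket x, 0) | x. x \<in> A}. dist y k < e" by blast
  qed
qed

lemma Kminus_eq_supported: "Kminus A = {(0, f) | f. \<forall>x. x \<notin> A \<longrightarrow> ell2_fun f x = 0}"
proof (intro equalityI subsetI)
  fix k :: "'a dbl"
  assume k: "k \<in> Kminus A"
  have "Kminus A \<subseteq> {k. (\<forall>x. x \<notin> {} \<longrightarrow> ell2_fun (fst k) x = 0) \<and> (\<forall>x. x \<notin> A \<longrightarrow> ell2_fun (snd k) x = 0)}"
    unfolding Kminus_def closed_cspan_def
    by (intro closure_minimal closed_supported dbl.span_minimal subspace_supported)
       (auto simp: ket.rep_eq zero_ell2.rep_eq)
  thus "k \<in> {(0, f) | f. \<forall>x. x \<notin> A \<longrightarrow> ell2_fun f x = 0}"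
    using k by (cases k) (auto simp: ell2_fun_eq_0)
next
  fix k :: "'a dbl"
  assume "k \<in> {(0, f) | f. \<forall>x. x \<notin> A \<longrightarrow> ell2_fun f x = 0}"
  then obtain f where k: "k = (0, f)" and f: "\<And>x. x \<notin> A \<Longrightarrow> ell2_fun f x = 0" by blast
  show "k \<in> Kminus A"
    unfolding Kminus_def closed_cspan_def closure_approachable
  proof (intro allI impI)
    fix e :: real assume "e > 0"
    obtain F where F: "finite F" "F \<subseteq> A"
        "dist (\<Sum>x\<in>F. scaleC_ell2 (ell2_fun f x) (ket x)) f < e"
      using ell2_finite_approx[OF f \<open>e > 0\<close>] by metis
    let ?l = "\<Sum>x\<in>F. scaleC (ell2_fun f x) (0, ket x)"
    have z: "scaleC_ell2 c 0 = 0" for c :: complex by transfer simp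
    have "?l = (0, (\<Sum>x\<in>F. scaleC_ell2 (ell2_fun f x) (ket x)))"
      by (simp add: scaleC_def sum_prod z)
    hence "dist ?l k < e" using F(3) by (simp add: k dist_Pair_Pair)
    moreover have "?l \<in> dbl.span {(0, ket x) | x. x \<in> A}"
      using F(2) by (intro dbl.span_sum dbl.span_scale dbl.span_base) auto
    ultimately show "\<exists>y\<in>dbl.span {(0, ket x) | x. x \<in> A}. dist y k < e" by blast
  qed
qed

lemma K_eq_supported:
  "K A = {k. \<forall>x. x \<notin> A \<longrightarrow> ell2_fun (fst k) x = 0 \<and> ell2_fun (snd k) x = 0}"
proof (intro equalityI subsetI)
  fix k assume "k \<in> K A"
  thus "k \<in> {k. \<forall>x. x \<notin> A \<longrightarrow> ell2_fun (fst k) x = 0 \<and> ell2_fun (snd k) x = 0}"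
    by (auto simp: K_def set_plus_def Kplus_eq_supported Kminus_eq_supported)
next
  fix k assume k: "k \<in> {k. \<forall>x. x \<notin> A \<longrightarrow> ell2_fun (fst k) x = 0 \<and> ell2_fun (snd k) x = 0}"
  have "(fst k, 0) \<in> Kplus A" "(0, snd k) \<in> Kminus A"
    using k by (auto simp: Kplus_eq_supported Kminus_eq_supported)
  hence "(fst k, 0) + (0, snd k) \<in> K A" unfolding K_def by (rule set_plus_intro)
  thus "k \<in> K A" by simp
qed

lemma K_UNIV: "K UNIV = UNIV"
  by (simp add: K_eq_supported)


section \<open>Projections and the Grassmannian\<close>

text \<open>
  An operator on a closed subspace \<open>H\<close> is represented by a function on the whole type, of which only
  the values on \<open>H\<close> matter.
\<close>

definition orth_projection_on :: "'x dbl set \<Rightarrow> ('x dbl \<Rightarrow> 'x dbl) \<Rightarrow> bool" where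
  "orth_projection_on H P \<longleftrightarrow>
     (\<forall>k\<in>H. P k \<in> H) \<and>
     (\<forall>k\<in>H. \<forall>l\<in>H. P (k + l) = P k + P l) \<and>
     (\<forall>c. \<forall>k\<in>H. P (scaleC c k) = scaleC c (P k)) \<and>
     (\<exists>C. \<forall>k\<in>H. norm (P k) \<le> C * norm k) \<and>
     (\<forall>k\<in>H. P (P k) = P k) \<and>
     (\<forall>k\<in>H. \<forall>l\<in>H. cinner (P k) l = cinner k (P l))"

definition Gr :: "'x set \<Rightarrow> ('x dbl \<Rightarrow> 'x dbl) set" where
  "Gr A = {P. orth_projection_on (K A) P \<and> (\<forall>k\<in>K A. Gam (P (Gam k)) = k - P k)}"

text \<open>
  The orthogonal projection onto a closed subspace \<open>V\<close>. It is meaningful only for such \<open>V\<close>, since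
  otherwise the described vector need not exist.
\<close>

definition orth_proj_onto :: "'x dbl set \<Rightarrow> 'x dbl \<Rightarrow> 'x dbl" where
  "orth_proj_onto V k = (THE p. p \<in> V \<and> (\<forall>v\<in>V. cinner v (k - p) = 0))"

definition PK :: "'x set \<Rightarrow> ('x dbl \<Rightarrow> 'x dbl) \<Rightarrow> 'x set \<Rightarrow> 'x set \<Rightarrow> 'x dbl set" where
  "PK XX P X X' = (P ` K XX + (Kplus X + Kminus X')) \<inter> K (XX - (X \<union> X'))"

definition reduced_proj ::
    "'x set \<Rightarrow> ('x dbl \<Rightarrow> 'x dbl) \<Rightarrow> 'x set \<Rightarrow> 'x set \<Rightarrow> 'x dbl \<Rightarrow> 'x dbl" where
  "reduced_proj XX P X X' = orth_proj_onto (PK XX P X X')"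

end

theory Submission
  imports Defs
begin

text \<open>
  Call a subspace \<open>V\<close> of a \<open>\<Gamma>\<close>-invariant space \<open>H\<close> Lagrangian if \<open>V\<close> and \<open>\<Gamma>V\<close> are orthogonal and
  \<open>H = V + \<Gamma>V\<close>. Such a \<open>V\<close> has an orthogonal projection \<open>u + \<Gamma>v \<mapsto> u\<close>, which \<open>\<Gamma>\<close> conjugates to its
  complement; conversely the range of any \<open>P\<close> in the Grassmannian is Lagrangian
  (\<open>orth_proj_onto_in_Gr\<close>, \<open>lagrangian_range\<close>). The theorem thus says that
  \<open>(V + W) \<inter> {W, \<Gamma>W}\<^sup>\<bottom>\<close> is Lagrangian in \<open>{W, \<Gamma>W}\<^sup>\<bottom>\<close>, where \<open>V = P ` K XX\<close> and
  \<open>W = Kplus X + Kminus X'\<close>. This is symplectic reduction, here for the symmetric form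
  \<open>\<langle>\<Gamma>k, l\<rangle>\<close>, along the subspace \<open>W\<close>, which is isotropic as \<open>X\<close> and \<open>X'\<close> are disjoint.

  Computing the annihilator of \<open>(V + W) \<inter> {W, \<Gamma>W}\<^sup>\<bottom>\<close> would involve closures of sums, and
  projecting onto this space would involve completeness. Instead, as \<open>W\<close> has finite dimension,
  one basis vector is added at a time (\<open>lagrangian_PK\<close>), and for a single isotropic vector the new
  decomposition is written down explicitly (\<open>lagrangian_reduction\<close>), so that the existence of the
  projection comes out of the algebra.
\<close>

section \<open>The inner product and the conjugation\<close>

lemma cinner_ell2_summable:
  "(\<lambda>x. cnj (ell2_fun f x) * ell2_fun g x) summable_on UNIV"
  by (rule abs_summable_summable) (simp add: norm_mult product_summable square_summable_ell2)

lemma cinner_ell2_add_right: "cinner_ell2 f (g + h) = cinner_ell2 f g + cinner_ell2 f h"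
  by (simp add: cinner_ell2_def plus_ell2.rep_eq distrib_left infsum_add cinner_ell2_summable)

lemma cinner_ell2_scale_right: "cinner_ell2 f (scaleC_ell2 c g) = c * cinner_ell2 f g"
  by (simp add: cinner_ell2_def scaleC_ell2.rep_eq mult.left_commute infsum_cmult_right')

lemma cinner_ell2_commute: "cinner_ell2 g f = cnj (cinner_ell2 f g)"
  by (simp add: cinner_ell2_def infsum_cnj[symmetric] mult.commute)

lemma cinner_ell2_conj: "cinner_ell2 (conj_ell2 f) (conj_ell2 g) = cinner_ell2 g f"
  by (simp add: cinner_ell2_def conj_ell2.rep_eq mult.commute)

lemma cinner_ell2_ket: "cinner_ell2 (ket x) f = ell2_fun f x"
proof -
  have "cinner_ell2 (ket x) f = (\<Sum>\<^sub>\<infinity>y\<in>{x}. ell2_fun f y)"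
    unfolding cinner_ell2_def by (rule infsum_cong_neutral) (auto simp: ket.rep_eq)
  thus ?thesis by simp
qed

lemma cinner_commute: "cinner l k = cnj (cinner k l)"
  by (simp add: cinner_def cinner_ell2_commute[of "fst l"] cinner_ell2_commute[of "snd l"])

lemma cinner_add_right: "cinner k (l + m) = cinner k l + cinner k m"
  by (simp add: cinner_def cinner_ell2_add_right)

lemma cinner_add_left: "cinner (k + l) m = cinner k m + cinner l m"
  by (metis cinner_commute cinner_add_right complex_cnj_add)

lemma cinner_scale_right: "cinner k (scaleC c l) = c * cinner k l"
  by (simp add: cinner_def scaleC_def cinner_ell2_scale_right distrib_left)

lemma cinner_scale_left: "cinner (scaleC c k) l = cnj c * cinner k l"
  by (metis cinner_commute cinner_scale_right complex_cnj_mult)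

lemma cinner_diff_right: "cinner k (l - m) = cinner k l - cinner k m"
  using cinner_add_right[of k "l - m" m] by simp

lemma cinner_diff_left: "cinner (k - l) m = cinner k m - cinner l m"
  using cinner_add_left[of "k - l" l m] by simp

lemma cinner_zero_right [simp]: "cinner k 0 = 0"
  using cinner_diff_right[of k 0 0] by simp

lemma cinner_zero_left [simp]: "cinner 0 k = 0"
  using cinner_diff_left[of 0 0 k] by simp

lemmas cinner_expand =
  cinner_add_left cinner_add_right cinner_diff_left cinner_diff_right
  cinner_scale_left cinner_scale_right

lemma cinner_self_eq_0_iff: "cinner k k = 0 \<longleftrightarrow> k = 0"
  using inner_eq_Re_cinner[of k k] by auto

lemma cinner_0_commute: "cinner k l = 0 \<longleftrightarrow> cinner l k = 0"
  using cinner_commute[of k l] by simp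

lemma Gam_Gam [simp]: "Gam (Gam k) = k"
proof -
  have "conj_ell2 (conj_ell2 f) = f" for f :: "'a ell2" by transfer simp
  thus ?thesis by (simp add: Gam_def)
qed

lemma Gam_add: "Gam (k + l) = Gam k + Gam l"
proof -
  have "conj_ell2 (f + g) = conj_ell2 f + conj_ell2 g" for f g :: "'a ell2" by transfer simp
  thus ?thesis by (simp add: Gam_def)
qed

lemma Gam_diff: "Gam (k - l) = Gam k - Gam l"
  using Gam_add[of "k - l" l] by simp

lemma Gam_zero [simp]: "Gam 0 = 0"
  using Gam_diff[of 0 0] by simp

lemma Gam_scaleC: "Gam (scaleC c k) = scaleC (cnj c) (Gam k)"
proof -
  have "conj_ell2 (scaleC_ell2 c f) = scaleC_ell2 (cnj c) (conj_ell2 f)" for f :: "'a ell2"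
    by transfer simp
  thus ?thesis by (simp add: Gam_def scaleC_def)
qed

lemma cinner_Gam_Gam: "cinner (Gam k) (Gam l) = cinner l k"
  by (simp add: cinner_def Gam_def cinner_ell2_conj)

text \<open>
  Because \<open>\<Gamma>\<close> is antiunitary, \<open>\<langle>\<Gamma>k, l\<rangle>\<close> is a symmetric bilinear form; it is the form for which
  subspaces are called isotropic and Lagrangian below.
\<close>

lemma cinner_Gam_commute: "cinner (Gam k) l = cinner (Gam l) k"
  using cinner_Gam_Gam[of k "Gam l"] by simp

section \<open>Lagrangian subspaces\<close>

definition lagrangian :: "'x dbl set \<Rightarrow> 'x dbl set \<Rightarrow> bool" where
  "lagrangian H V \<longleftrightarrow> dbl.subspace V \<and> V \<subseteq> H \<and> (\<forall>u\<in>V. \<forall>v\<in>V. cinner (Gam u) v = 0) \<and>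
     (\<forall>k\<in>H. \<exists>u\<in>V. \<exists>v\<in>V. k = u + Gam v)"

lemma subspace_K: "dbl.subspace (K A)"
  by (auto simp: K_eq_supported dbl.subspace_def scaleC_def scaleC_ell2.rep_eq plus_ell2.rep_eq
      zero_ell2.rep_eq)

lemma Gam_in_K: "k \<in> K A \<Longrightarrow> Gam k \<in> K A"
  by (auto simp: K_eq_supported Gam_def conj_ell2.rep_eq)

text \<open>
  Isotropy of the range comes from \<open>P\<Gamma>P = \<Gamma>(1 - P)P = 0\<close>, and \<open>1 - P = \<Gamma>P\<Gamma>\<close> has range in \<open>\<Gamma>V\<close>.
\<close>

lemma lagrangian_range:
  assumes "P \<in> Gr A"
  shows "lagrangian (K A) (P ` K A)"
proof -
  have P: "\<And>k. k \<in> K A \<Longrightarrow> P k \<in> K A"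
    "\<And>k l. k \<in> K A \<Longrightarrow> l \<in> K A \<Longrightarrow> P (k + l) = P k + P l"
    "\<And>c k. k \<in> K A \<Longrightarrow> P (scaleC c k) = scaleC c (P k)"
    "\<And>k. k \<in> K A \<Longrightarrow> P (P k) = P k"
    "\<And>k l. k \<in> K A \<Longrightarrow> l \<in> K A \<Longrightarrow> cinner (P k) l = cinner k (P l)"
    "\<And>k. k \<in> K A \<Longrightarrow> Gam (P (Gam k)) = k - P k"
    using assms by (auto simp: Gr_def orth_projection_on_def)
  note sub = subspace_K[of A]
  have P0: "P 0 = 0"
    using P(2)[of 0 0] dbl.subspace_0[OF sub] by simp
  have "dbl.subspace (P ` K A)"
    unfolding dbl.subspace_def
  proof (intro conjI ballI allI)
    show "0 \<in> P ` K A" using P0 dbl.subspace_0[OF sub] by (metis imageI)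
    show "k + l \<in> P ` K A" if "k \<in> P ` K A" "l \<in> P ` K A" for k l
      using that P(2) dbl.subspace_add[OF sub] by (metis (no_types, lifting) image_iff)
    show "scaleC c k \<in> P ` K A" if "k \<in> P ` K A" for c k
      using that P(3) dbl.subspace_scale[OF sub] by (metis (no_types, lifting) image_iff)
  qed
  moreover have "cinner (Gam (P a)) (P b) = 0" if "a \<in> K A" "b \<in> K A" for a b
  proof -
    have "Gam (P (Gam (P a))) = 0" using P(1,4,6) that by simp
    hence "P (Gam (P a)) = 0" by (metis Gam_Gam Gam_zero)
    thus ?thesis using P(5)[of "Gam (P a)" b] that P(1) Gam_in_K by (metis cinner_zero_left)
  qed
  moreover have "\<exists>u\<in>P ` K A. \<exists>v\<in>P ` K A. k = u + Gam v" if "k \<in> K A" for k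
  proof (intro bexI)
    show "k = P k + Gam (P (Gam k))" using P(6)[OF that] by simp
  qed (use that Gam_in_K[OF that] in simp_all)
  ultimately show ?thesis using P(1) unfolding lagrangian_def by blast
qed

lemma orth_proj_onto_lagrangian:
  assumes "lagrangian H V" "u \<in> V" "v \<in> V"
  shows "orth_proj_onto V (u + Gam v) = u"
  unfolding orth_proj_onto_def
proof (rule the_equality)
  have orth: "cinner w (Gam v) = 0" if "w \<in> V" for w
    using assms that unfolding lagrangian_def by (metis cinner_0_commute)
  thus "u \<in> V \<and> (\<forall>w\<in>V. cinner w (u + Gam v - u) = 0)" using assms(2) by simp
  fix p assume p: "p \<in> V \<and> (\<forall>w\<in>V. cinner w (u + Gam v - p) = 0)"
  have "u - p \<in> V" using p assms by (simp add: lagrangian_def dbl.subspace_diff)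
  hence "cinner (u - p) (u + Gam v - p) = 0" "cinner (u - p) (Gam v) = 0"
    using p orth by auto
  hence "cinner (u - p) (u - p) = 0" by (simp add: cinner_expand)
  thus "p = u" by (simp add: cinner_self_eq_0_iff)
qed

lemma orth_proj_onto_in_Gr:
  assumes L: "lagrangian (K A) V"
  shows "orth_proj_onto V \<in> Gr A"
proof -
  let ?Q = "orth_proj_onto V"
  have sub: "dbl.subspace V" and VK: "V \<subseteq> K A"
    and iso: "\<And>u v. u \<in> V \<Longrightarrow> v \<in> V \<Longrightarrow> cinner (Gam u) v = 0"
    and ex: "\<And>k. k \<in> K A \<Longrightarrow> \<exists>u v. u \<in> V \<and> v \<in> V \<and> k = u + Gam v"
    using L unfolding lagrangian_def by blast+
  note Q = orth_proj_onto_lagrangian[OF L]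
  have iso': "cinner u (Gam v) = 0" if "u \<in> V" "v \<in> V" for u v
    using iso that by (metis cinner_0_commute)
  have "orth_projection_on (K A) ?Q"
    unfolding orth_projection_on_def
  proof (intro conjI ballI allI)
    fix k assume "k \<in> K A"
    then obtain u v where k: "u \<in> V" "v \<in> V" "k = u + Gam v" using ex by blast
    show "?Q k \<in> K A" using k Q VK by auto
    show "?Q (?Q k) = ?Q k"
      using Q[OF k(1) dbl.subspace_0[OF sub]] Q[OF k(1,2)] k(3) by simp
    show "?Q (scaleC c k) = scaleC c (?Q k)" for c
      using Q[of "scaleC c u" "scaleC (cnj c) v"] Q[OF k(1,2)] k
      by (simp add: dbl.scale_right_distrib Gam_scaleC dbl.subspace_scale[OF sub])
    fix l assume "l \<in> K A"
    then obtain u' v' where l: "u' \<in> V" "v' \<in> V" "l = u' + Gam v'" using ex by blast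
    have "k + l = (u + u') + Gam (v + v')"
      using k(3) l(3) by (simp add: Gam_add algebra_simps)
    moreover have "?Q ((u + u') + Gam (v + v')) = u + u'"
      using k l by (intro Q dbl.subspace_add[OF sub])
    ultimately show "?Q (k + l) = ?Q k + ?Q l"
      using Q[OF k(1,2)] Q[OF l(1,2)] k(3) l(3) by metis
    show "cinner (?Q k) l = cinner k (?Q l)"
      using Q[OF k(1,2)] Q[OF l(1,2)] k l iso iso' by (simp add: cinner_expand)
  next
    have "norm (?Q k) \<le> 1 * norm k" if "k \<in> K A" for k
    proof -
      from that obtain u v where k: "u \<in> V" "v \<in> V" "k = u + Gam v" using ex by blast
      have "u \<bullet> Gam v = 0" using iso' k by (simp add: inner_eq_Re_cinner)
      hence "(norm u)\<^sup>2 \<le> (norm k)\<^sup>2"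
        using k(3) by (simp add: power2_norm_eq_inner inner_add_left inner_add_right inner_commute)
      thus ?thesis using Q[OF k(1,2)] k(3) by (auto intro: power2_le_imp_le)
    qed
    thus "\<exists>C. \<forall>k\<in>K A. norm (?Q k) \<le> C * norm k" by blast
  qed
  moreover have "Gam (?Q (Gam k)) = k - ?Q k" if "k \<in> K A" for k
  proof -
    from that obtain u v where k: "u \<in> V" "v \<in> V" "k = u + Gam v" using ex by blast
    have "Gam k = v + Gam u" using k(3) by (simp add: Gam_add)
    thus ?thesis using Q[OF k(1,2)] Q[OF k(2,1)] k(3) by simp
  qed
  ultimately show ?thesis unfolding Gr_def by blast
qed

section \<open>Reduction along one isotropic vector\<close>

definition line :: "'x dbl \<Rightarrow> 'x dbl set" where
  "line w = range (\<lambda>c. scaleC c w)"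

lemma mem_plus_line: "k \<in> V + line w \<longleftrightarrow> (\<exists>v\<in>V. \<exists>c. k = v + scaleC c w)"
  by (auto simp: set_plus_def line_def)

lemma subspace_plus_line:
  assumes "dbl.subspace V"
  shows "dbl.subspace (V + line w)"
  unfolding dbl.subspace_def
proof (intro conjI ballI allI)
  show "0 \<in> V + line w"
    unfolding mem_plus_line
    by (rule bexI[of _ 0], rule exI[of _ 0]) (auto simp: dbl.subspace_0[OF assms])
  fix k assume "k \<in> V + line w"
  then obtain v c where k: "v \<in> V" "k = v + scaleC c w" unfolding mem_plus_line by blast
  show "scaleC a k \<in> V + line w" for a
    unfolding mem_plus_line
    by (rule bexI[of _ "scaleC a v"], rule exI[of _ "a * c"])
       (use k in \<open>auto simp: dbl.scale_right_distrib dbl.subspace_scale[OF assms]\<close>)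
  fix l assume "l \<in> V + line w"
  then obtain v' c' where l: "v' \<in> V" "l = v' + scaleC c' w" unfolding mem_plus_line by blast
  show "k + l \<in> V + line w"
    unfolding mem_plus_line
    by (rule bexI[of _ "v + v'"], rule exI[of _ "c + c'"])
       (use k l in \<open>auto simp: dbl.scale_left_distrib dbl.subspace_add[OF assms]\<close>)
qed

text \<open>
  Let \<open>w = p + q\<close> with \<open>p \<in> V\<close>, \<open>q \<in> \<Gamma>V\<close>. The vectors \<open>q\<close> and \<open>\<Gamma>q\<close> lie both in \<open>V + \<complex>w\<close> and in
  \<open>\<Gamma>(V + \<complex>w)\<close>, so a decomposition \<open>k = u + \<Gamma>v\<close> of \<open>k \<in> H'\<close> can be corrected by any combination
  \<open>z = c q + d \<Gamma>q\<close>, moving it from one summand to the other. Isotropy of \<open>w\<close> gives \<open>\<langle>p, \<Gamma>q\<rangle> = 0\<close>,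
  whence \<open>\<langle>w, z\<rangle> = c \<parallel>q\<parallel>\<^sup>2\<close> and \<open>\<langle>\<Gamma>w, z\<rangle> = d \<parallel>q\<parallel>\<^sup>2\<close>: exactly one choice puts \<open>u + z\<close> into \<open>H'\<close> when
  \<open>q \<noteq> 0\<close>, and for \<open>q = 0\<close> no correction is required.
\<close>

lemma lagrangian_reduction:
  assumes L: "lagrangian H V" and H: "dbl.subspace H" and GH: "\<And>k. k \<in> H \<Longrightarrow> Gam k \<in> H"
    and w: "w \<in> H" "cinner (Gam w) w = 0"
  defines "H' \<equiv> {k \<in> H. cinner w k = 0 \<and> cinner (Gam w) k = 0}"
  shows "lagrangian H' ((V + line w) \<inter> H')"
proof -
  have sub: "dbl.subspace V" and VH: "V \<subseteq> H"
    and iso: "\<And>u v. u \<in> V \<Longrightarrow> v \<in> V \<Longrightarrow> cinner (Gam u) v = 0"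
    and ex: "\<And>k. k \<in> H \<Longrightarrow> \<exists>u v. u \<in> V \<and> v \<in> V \<and> k = u + Gam v"
    using L unfolding lagrangian_def by blast+
  have iso': "cinner u (Gam v) = 0" if "u \<in> V" "v \<in> V" for u v
    using iso that by (metis cinner_0_commute)
  have H': "dbl.subspace H'"
    using H unfolding H'_def dbl.subspace_def by (auto simp: cinner_expand)
  have GH': "Gam k \<in> H'" if "k \<in> H'" for k
    using that GH cinner_Gam_commute[of w k] cinner_Gam_Gam[of w k]
      cinner_0_commute[of w k] cinner_0_commute[of w "Gam k"]
    unfolding H'_def by auto
  have "dbl.subspace ((V + line w) \<inter> H')"
    by (intro dbl.subspace_inter subspace_plus_line sub H')
  moreover have "cinner (Gam k) l = 0"
    if k: "k \<in> (V + line w) \<inter> H'" and l: "l \<in> (V + line w) \<inter> H'" for k l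
  proof -
    obtain m a where m: "m \<in> V" "k = m + scaleC a w" using k by (auto simp: mem_plus_line)
    obtain n b where n: "n \<in> V" "l = n + scaleC b w" using l by (auto simp: mem_plus_line)
    have "cinner (Gam w) l = 0" "cinner (Gam k) w = 0"
      using k l cinner_Gam_commute[of k w] by (auto simp: H'_def)
    moreover have "cinner (Gam (k - scaleC a w)) (l - scaleC b w) = 0"
      using iso m n by simp
    ultimately show ?thesis using w(2) by (simp add: Gam_diff Gam_scaleC cinner_expand)
  qed
  moreover have "\<exists>u\<in>(V + line w) \<inter> H'. \<exists>v\<in>(V + line w) \<inter> H'. k = u + Gam v"
    if k: "k \<in> H'" for k
  proof -
    obtain u v where uv: "u \<in> V" "v \<in> V" "k = u + Gam v" using ex k H'_def by blast
    \<comment> \<open>Here \<open>q = \<Gamma>r\<close>.\<close>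
    obtain p r where pr: "p \<in> V" "r \<in> V" "w = p + Gam r" using ex w(1) by blast
    have pr0: "cinner p r = 0" "cinner r p = 0"
    proof -
      have "cinner (Gam w) w = cinner (Gam p) (Gam r) + cinner r p"
        using pr iso iso' by (simp add: Gam_add cinner_expand)
      thus "cinner r p = 0" using w(2) by (simp add: cinner_Gam_Gam)
      thus "cinner p r = 0" by (metis cinner_0_commute)
    qed
    define N where "N = cinner r r"
    define c where "c = - cinner w u / N"
    define d where "d = - cinner (Gam w) u / N"
    define z where "z = scaleC c (Gam r) + scaleC d r"
    have wz: "cinner w z = c * N" "cinner (Gam w) z = d * N"
      using pr pr0 iso iso'
      by (simp_all add: z_def N_def Gam_add cinner_expand cinner_Gam_Gam)
    have cd: "c * N = - cinner w u" "d * N = - cinner (Gam w) u"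
    proof -
      have "cinner w u = 0 \<and> cinner (Gam w) u = 0" if "N = 0"
      proof -
        have "w = p" using that pr(3) by (simp add: N_def cinner_self_eq_0_iff)
        moreover have "cinner w k = 0" using k by (simp add: H'_def)
        ultimately show ?thesis using pr uv iso iso' by (simp add: cinner_expand)
      qed
      thus "c * N = - cinner w u" "d * N = - cinner (Gam w) u"
        by (auto simp: c_def d_def)
    qed
    have Gr: "Gam r = w - p" using pr(3) by simp
    have mem: "x + scaleC a (Gam r) \<in> V + line w" if "x \<in> V" for x a
      unfolding mem_plus_line
      by (rule bexI[of _ "x - scaleC a p"], rule exI[of _ a])
         (use that pr in \<open>auto simp: Gr dbl.scale_right_diff_distrib
            intro!: dbl.subspace_diff[OF sub] dbl.subspace_scale[OF sub]\<close>)
    have inH: "x \<in> H" if "x \<in> V + line w" for x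
      using that VH w(1) by (auto simp: mem_plus_line intro!: dbl.subspace_add[OF H] dbl.subspace_scale[OF H])
    have "u + z = (u + scaleC d r) + scaleC c (Gam r)"
      by (simp add: z_def algebra_simps)
    moreover have "(u + scaleC d r) + scaleC c (Gam r) \<in> V + line w"
      using uv(1) pr(2) by (intro mem dbl.subspace_add[OF sub] dbl.subspace_scale[OF sub])
    ultimately have 1: "u + z \<in> V + line w" by metis
    have "v - Gam z = (v - scaleC (cnj c) r) + scaleC (- cnj d) (Gam r)"
      by (simp add: z_def Gam_add Gam_scaleC)
    moreover have "(v - scaleC (cnj c) r) + scaleC (- cnj d) (Gam r) \<in> V + line w"
      using uv(2) pr(2) by (intro mem dbl.subspace_diff[OF sub] dbl.subspace_scale[OF sub])
    ultimately have 2: "v - Gam z \<in> V + line w" by metis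
    have 3: "u + z \<in> H'"
      using inH[OF 1] wz cd by (simp add: H'_def cinner_expand)
    have eq: "k = (u + z) + Gam (v - Gam z)" using uv(3) by (simp add: Gam_diff)
    hence "v - Gam z = Gam (k - (u + z))" by simp
    hence "v - Gam z \<in> H'" using GH' dbl.subspace_diff[OF H' k 3] by simp
    thus ?thesis using 1 2 3 eq by blast
  qed
  ultimately show ?thesis unfolding lagrangian_def by blast
qed

section \<open>Removing the points one at a time\<close>

lemma cinner_ket_left: "cinner (ket x, 0) k = ell2_fun (fst k) x"
  and cinner_ket_right: "cinner (0, ket x) k = ell2_fun (snd k) x"
proof -
  have "cinner_ell2 0 f = 0" for f :: "'a ell2"
    by (simp add: cinner_ell2_def zero_ell2.rep_eq)
  thus "cinner (ket x, 0) k = ell2_fun (fst k) x" "cinner (0, ket x) k = ell2_fun (snd k) x"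
    by (simp_all add: cinner_def cinner_ell2_ket)
qed

lemma Gam_ket: "Gam (ket x, 0) = (0, ket x)" "Gam (0, ket x) = (ket x, 0)"
proof -
  have "conj_ell2 (ket x) = ket x" "conj_ell2 0 = (0 :: 'a ell2)" by (transfer; auto)+
  thus "Gam (ket x, 0) = (0, ket x)" "Gam (0, ket x) = (ket x, 0)" by (simp_all add: Gam_def)
qed

lemma lagrangian_remove_point:
  assumes L: "lagrangian (K A) V" and x: "x \<in> A" and w: "w = (ket x, 0) \<or> w = (0, ket x)"
  shows "lagrangian (K (A - {x})) ((V + line w) \<inter> K (A - {x}))"
proof -
  have "w \<in> K A" using x w by (auto simp: K_eq_supported ket.rep_eq zero_ell2.rep_eq)
  moreover have "cinner (Gam w) w = 0"
    using w by (auto simp: Gam_ket cinner_ket_left cinner_ket_right zero_ell2.rep_eq)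
  moreover have "{k \<in> K A. cinner w k = 0 \<and> cinner (Gam w) k = 0} = K (A - {x})"
    using w by (auto simp: Gam_ket cinner_ket_left cinner_ket_right K_eq_supported)
  ultimately show ?thesis
    using lagrangian_reduction[OF L subspace_K Gam_in_K, of w] by simp
qed

lemma plus_line_Int_in_stages:
  assumes A: "dbl.subspace A" and "B \<subseteq> A" "w \<in> A"
  shows "((S \<inter> A) + line w) \<inter> B = (S + line w) \<inter> B"
proof (intro equalityI subsetI)
  fix k assume "k \<in> (S + line w) \<inter> B"
  then obtain s c where k: "s \<in> S" "k = s + scaleC c w" "k \<in> B" by (auto simp: mem_plus_line)
  have "k - scaleC c w \<in> A"
    using k(3) assms by (intro dbl.subspace_diff dbl.subspace_scale) auto
  thus "k \<in> ((S \<inter> A) + line w) \<inter> B" using k by (auto simp: mem_plus_line)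
qed (auto simp: mem_plus_line)

lemma supported_insert:
  assumes "\<forall>y. y \<notin> insert x X \<longrightarrow> ell2_fun f y = 0"
  obtains g c where "f = g + scaleC_ell2 c (ket x)" "\<forall>y. y \<notin> X \<longrightarrow> ell2_fun g y = 0"
proof
  let ?c = "ell2_fun f x"
  show "f = (f - scaleC_ell2 ?c (ket x)) + scaleC_ell2 ?c (ket x)" by simp
  show "\<forall>y. y \<notin> X \<longrightarrow> ell2_fun (f - scaleC_ell2 ?c (ket x)) y = 0"
    using assms by (auto simp: minus_ell2.rep_eq scaleC_ell2.rep_eq ket.rep_eq)
qed

lemma scaleC_ell2_zero: "scaleC_ell2 c 0 = 0"
  by transfer simp

lemma Kplus_insert: "Kplus (insert x X) = Kplus X + line (ket x, 0)"
proof (intro equalityI subsetI)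
  fix k assume "k \<in> Kplus (insert x X)"
  then obtain f where k: "k = (f, 0)" "\<forall>y. y \<notin> insert x X \<longrightarrow> ell2_fun f y = 0"
    unfolding Kplus_eq_supported by blast
  obtain g c where "f = g + scaleC_ell2 c (ket x)" "\<forall>y. y \<notin> X \<longrightarrow> ell2_fun g y = 0"
    using supported_insert[OF k(2)] .
  hence "k = (g, 0) + scaleC c (ket x, 0)" "(g, 0) \<in> Kplus X"
    using k(1) by (simp_all add: scaleC_def scaleC_ell2_zero Kplus_eq_supported)
  thus "k \<in> Kplus X + line (ket x, 0)"
    unfolding mem_plus_line by blast
qed (auto simp: mem_plus_line Kplus_eq_supported scaleC_def scaleC_ell2_zero
      plus_ell2.rep_eq scaleC_ell2.rep_eq ket.rep_eq)

lemma Kminus_insert: "Kminus (insert x X) = Kminus X + line (0, ket x)"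
proof (intro equalityI subsetI)
  fix k assume "k \<in> Kminus (insert x X)"
  then obtain f where k: "k = (0, f)" "\<forall>y. y \<notin> insert x X \<longrightarrow> ell2_fun f y = 0"
    unfolding Kminus_eq_supported by blast
  obtain g c where "f = g + scaleC_ell2 c (ket x)" "\<forall>y. y \<notin> X \<longrightarrow> ell2_fun g y = 0"
    using supported_insert[OF k(2)] .
  hence "k = (0, g) + scaleC c (0, ket x)" "(0, g) \<in> Kminus X"
    using k(1) by (simp_all add: scaleC_def scaleC_ell2_zero Kminus_eq_supported)
  thus "k \<in> Kminus X + line (0, ket x)"
    unfolding mem_plus_line by blast
qed (auto simp: mem_plus_line Kminus_eq_supported scaleC_def scaleC_ell2_zero
      plus_ell2.rep_eq scaleC_ell2.rep_eq ket.rep_eq)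

lemma Kplus_empty: "Kplus {} = 0" and Kminus_empty: "Kminus {} = 0"
  by (auto simp: Kplus_eq_supported Kminus_eq_supported ell2_fun_eq_0 set_zero zero_prod_def)

text \<open>
  The two inductions, on \<open>X\<close> and on \<open>X'\<close>, share this step; \<open>S\<close> is
  \<open>P ` K XX + (Kplus X + Kminus X')\<close>. Intersecting only at the end gives the same space as
  intersecting after each step, because the next vector \<open>w\<close> lies in the space left so far.
\<close>

lemma lagrangian_remove_next_point:
  assumes L: "lagrangian (K A) (S \<inter> K A)" and x: "x \<in> A"
    and w: "w = (ket x, 0) \<or> w = (0, ket x)"
  shows "lagrangian (K (A - {x})) ((S + line w) \<inter> K (A - {x}))"
proof -
  have "w \<in> K A" using x w by (auto simp: K_eq_supported ket.rep_eq zero_ell2.rep_eq)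
  moreover have "K (A - {x}) \<subseteq> K A" by (auto simp: K_eq_supported)
  ultimately show ?thesis
    using lagrangian_remove_point[OF L x w] plus_line_Int_in_stages[OF subspace_K, of _ A w S]
    by simp
qed

lemma lagrangian_PK:
  assumes P: "P \<in> Gr XX" and "finite X" "finite X'" "X \<subseteq> XX" "X' \<subseteq> XX" "X \<inter> X' = {}"
  shows "lagrangian (K (XX - (X \<union> X'))) (PK XX P X X')"
  using assms(3,5,6)
proof (induction X' rule: finite_induct)
  case empty
  show ?case using assms(2,4)
  proof (induction X rule: finite_induct)
    case empty
    have "P ` K XX \<inter> K XX = P ` K XX"
      using lagrangian_range[OF P] unfolding lagrangian_def by blast
    thus ?case using lagrangian_range[OF P] by (simp add: PK_def Kplus_empty Kminus_empty)
  next
    case (insert x X)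
    have "XX - (insert x X \<union> {}) = XX - (X \<union> {}) - {x}" by blast
    hence "PK XX P (insert x X) {} =
        (P ` K XX + (Kplus X + Kminus {}) + line (ket x, 0)) \<inter> K (XX - (X \<union> {}) - {x})"
      unfolding PK_def Kplus_insert by (simp add: ac_simps)
    moreover have "lagrangian (K (XX - (X \<union> {}))) (PK XX P X {})"
      using insert by simp
    moreover have "x \<in> XX - (X \<union> {})"
      using insert by simp
    ultimately show ?case
      using lagrangian_remove_next_point[of "XX - (X \<union> {})" _ x "(ket x, 0)"]
        \<open>XX - (insert x X \<union> {}) = XX - (X \<union> {}) - {x}\<close>
      unfolding PK_def[of XX P X] by metis
  qed
next
  case (insert x X')
  have "XX - (X \<union> insert x X') = XX - (X \<union> X') - {x}" by blast
  hence "PK XX P X (insert x X') =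
      (P ` K XX + (Kplus X + Kminus X') + line (0, ket x)) \<inter> K (XX - (X \<union> X') - {x})"
    unfolding PK_def Kminus_insert by (simp add: ac_simps)
  moreover have "lagrangian (K (XX - (X \<union> X'))) (PK XX P X X')"
    using insert by simp
  moreover have "x \<in> XX - (X \<union> X')"
    using insert by simp
  ultimately show ?case
    using lagrangian_remove_next_point[of "XX - (X \<union> X')" _ x "(0, ket x)"]
      \<open>XX - (X \<union> insert x X') = XX - (X \<union> X') - {x}\<close>
    unfolding PK_def[of XX P X X'] by metis
qed

theorem lemma1p15:
  fixes XX X X' :: "'x set" and P :: "'x dbl \<Rightarrow> 'x dbl"
  assumes "countable XX"
    and "P \<in> Gr XX"
    and "X \<subseteq> XX" and "X' \<subseteq> XX"
    and "finite X" and "finite X'"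
    and "X \<inter> X' = {}"
  shows "reduced_proj XX P X X' \<in> Gr (XX - (X \<union> X'))"
  unfolding reduced_proj_def
  using assms by (intro orth_proj_onto_in_Gr lagrangian_PK)

end
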